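(* Let $a\in C^1([-1,1])$ with $a>0$ on $(-1,1)$ and $a(-1)=a(1)=0$, and let $\xi_a(x)=\int_0^x\frac{ds}{a(s)}$. Let $T>0$, $\vartheta\ge1$ and $Q_T=(0,T)\times(-1,1)$. If $\xi_a\in L^{2\vartheta-1}(-1,1)$, then $$\mathcal H(Q_T)\subset L^{2\vartheta}(Q_T),$$ and there is a positive constant $c$ such that for all $u\in\mathcal H(Q_T)$ $$\|u\|_{L^{2\vartheta}(Q_T)}\le c\,T^{\frac1{2\vartheta}}\,\|u\|_{\mathcal H(Q_T)} .$$
   Context: $H^1_a(-1,1)=\{u\in L^2(-1,1): u$ is locally absolutely continuous in $(-1,1)$ and $\sqrt a\,u_x\in L^2(-1,1)\}$, with norm $\|u\|_{1,a}^2=\|u\|_{L^2}^2+\|\sqrt a\,u_x\|_{L^2}^2$; $H^2_a(-1,1)=\{u\in H^1_a(-1,1): au_x\in H^1(-1,1)\}$, with norm $\|u\|_{2,a}^2=\|u\|_{1,a}^2+\|(au_x)_x\|_{L^2}^2$. $\mathcal H(Q_T)=L^2(0,T;H^2_a(-1,1))\cap H^1(0,T;L^2(-1,1))\cap C([0,T];H^1_a(-1,1))$ with norm $\|u\|_{\mathcal H(Q_T)}^2=\sup_{[0,T]}\big(\|u\|_{L^2}^2+\|\sqrt a\,u_x\|_{L^2}^2\big)+\int_0^T\big(\|u_t\|_{L^2}^2+\|(au_x)_x\|_{L^2}^2\big)dt$, where $L^2=L^2(-1,1)$. The constant $c$ does not depend on $u$. *)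

theory Defs
  imports "HOL-Analysis.Analysis"
begin

text \<open>
  Elements of the function spaces below are represented by real functions; two functions that
  agree almost everywhere represent the same element, and the ``norms'' are the corresponding
  seminorms.  Values outside the stated domain are irrelevant.
\<close>

section \<open>Lebesgue and Sobolev spaces on an interval\<close>

definition C1_on :: "real set \<Rightarrow> (real \<Rightarrow> real) \<Rightarrow> bool" where
  "C1_on S f \<longleftrightarrow>
     (\<exists>f'. (\<forall>x\<in>S. (f has_real_derivative f' x) (at x within S)) \<and> continuous_on S f')"

definition Lp :: "real \<Rightarrow> 'a measure \<Rightarrow> ('a \<Rightarrow> real) set" where
  "Lp p M = {f \<in> borel_measurable M. integrable M (\<lambda>x. \<bar>f x\<bar> powr p)}"

definition Lp_norm :: "real \<Rightarrow> 'a measure \<Rightarrow> ('a \<Rightarrow> real) \<Rightarrow> real" where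
  "Lp_norm p M f = (LINT x|M. \<bar>f x\<bar> powr p) powr (1 / p)"

abbreviation I1 :: "real set" where
  "I1 \<equiv> {-1<..<1}"

abbreviation L2 :: "(real \<Rightarrow> real) set" where
  "L2 \<equiv> Lp 2 (lebesgue_on I1)"

abbreviation L2_norm :: "(real \<Rightarrow> real) \<Rightarrow> real" where
  "L2_norm \<equiv> Lp_norm 2 (lebesgue_on I1)"

definition abs_continuous_on :: "real set \<Rightarrow> (real \<Rightarrow> real) \<Rightarrow> bool" where
  "abs_continuous_on S f \<longleftrightarrow>
     (\<forall>\<epsilon>>0. \<exists>\<delta>>0. \<forall>D. D division_of \<Union>D \<and> \<Union>D \<subseteq> S \<and> (\<Sum>K\<in>D. Sup K - Inf K) < \<delta>
        \<longrightarrow> (\<Sum>K\<in>D. \<bar>f (Sup K) - f (Inf K)\<bar>) < \<epsilon>)"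

definition locally_abs_continuous_on :: "real set \<Rightarrow> (real \<Rightarrow> real) \<Rightarrow> bool" where
  "locally_abs_continuous_on S f \<longleftrightarrow> (\<forall>\<alpha> \<beta>. {\<alpha>..\<beta>} \<subseteq> S \<longrightarrow> abs_continuous_on {\<alpha>..\<beta>} f)"

text \<open>Smooth functions with compact support in \<open>S\<close>.\<close>

definition test_functions :: "real set \<Rightarrow> (real \<Rightarrow> real) set" where
  "test_functions S =
     {\<phi>. (\<forall>k x. (deriv ^^ k) \<phi> differentiable (at x)) \<and>
         (\<exists>K. compact K \<and> K \<subseteq> S \<and> (\<forall>x. x \<notin> K \<longrightarrow> \<phi> x = 0))}"

definition has_weak_deriv :: "real set \<Rightarrow> (real \<Rightarrow> real) \<Rightarrow> (real \<Rightarrow> real) \<Rightarrow> bool" where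
  "has_weak_deriv S w g \<longleftrightarrow>
     (\<forall>K. compact K \<and> K \<subseteq> S \<longrightarrow> integrable (lebesgue_on K) w \<and> integrable (lebesgue_on K) g) \<and>
     (\<forall>\<phi>\<in>test_functions S.
        (LINT x|lebesgue_on S. w x * deriv \<phi> x) = - (LINT x|lebesgue_on S. g x * \<phi> x))"

text \<open>The weak derivative is unique up to null sets, which is all that integrals depend on.\<close>

definition weak_deriv :: "real set \<Rightarrow> (real \<Rightarrow> real) \<Rightarrow> (real \<Rightarrow> real)" where
  "weak_deriv S w = (SOME g. has_weak_deriv S w g)"

definition H1 :: "(real \<Rightarrow> real) set" where
  "H1 = {w \<in> L2. \<exists>g\<in>L2. has_weak_deriv I1 w g}"

section \<open>Weighted Sobolev spaces\<close>

text \<open>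
  For a locally absolutely continuous \<open>u\<close>, the derivative \<open>u\<^sub>x\<close> is the classical one, which
  exists almost everywhere.  The differentiability clause only records that \<open>deriv u\<close>, a total
  function with unspecified values where \<open>u\<close> is not differentiable, is \<open>u\<^sub>x\<close> almost everywhere;
  by Lebesgue's theorem it is implied by local absolute continuity.
\<close>

definition H1a :: "(real \<Rightarrow> real) \<Rightarrow> (real \<Rightarrow> real) set" where
  "H1a a = {u \<in> L2. locally_abs_continuous_on I1 u \<and>
                    (AE x in lebesgue_on I1. u differentiable (at x)) \<and>
                    (\<lambda>x. sqrt (a x) * deriv u x) \<in> L2}"

definition H1a_norm :: "(real \<Rightarrow> real) \<Rightarrow> (real \<Rightarrow> real) \<Rightarrow> real" where
  "H1a_norm a u = sqrt ((L2_norm u)\<^sup>2 + (L2_norm (\<lambda>x. sqrt (a x) * deriv u x))\<^sup>2)"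

definition H2a :: "(real \<Rightarrow> real) \<Rightarrow> (real \<Rightarrow> real) set" where
  "H2a a = {u \<in> H1a a. (\<lambda>x. a x * deriv u x) \<in> H1}"

text \<open>The function \<open>(a u\<^sub>x)\<^sub>x\<close>.\<close>

definition flux_deriv :: "(real \<Rightarrow> real) \<Rightarrow> (real \<Rightarrow> real) \<Rightarrow> (real \<Rightarrow> real)" where
  "flux_deriv a u = weak_deriv I1 (\<lambda>x. a x * deriv u x)"

definition H2a_norm :: "(real \<Rightarrow> real) \<Rightarrow> (real \<Rightarrow> real) \<Rightarrow> real" where
  "H2a_norm a u = sqrt ((H1a_norm a u)\<^sup>2 + (L2_norm (flux_deriv a u))\<^sup>2)"

section \<open>Spaces of vector-valued functions of time\<close>

text \<open>
  In this section \<open>X\<close> is a linear space of functions of \<open>x\<close> with seminorm \<open>N\<close>, and \<open>f t\<close> is the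
  value at time \<open>t\<close> of a function \<open>f\<close> with values in \<open>X\<close>.
\<close>

definition simple_valued ::
  "real \<Rightarrow> (real \<Rightarrow> real) set \<Rightarrow> (real \<Rightarrow> real \<Rightarrow> real) \<Rightarrow> bool" where
  "simple_valued T X s \<longleftrightarrow>
     (\<exists>(n::nat) A v. (\<forall>i<n. A i \<in> sets (lebesgue_on {0<..<T}) \<and> v i \<in> X) \<and>
                     s = (\<lambda>t x. \<Sum>i<n. indicator (A i) t * v i x))"

definition strongly_measurable ::
  "real \<Rightarrow> (real \<Rightarrow> real) set \<Rightarrow> ((real \<Rightarrow> real) \<Rightarrow> real) \<Rightarrow> (real \<Rightarrow> real \<Rightarrow> real) \<Rightarrow> bool" where
  "strongly_measurable T X N f \<longleftrightarrow>
     (\<exists>s. (\<forall>n. simple_valued T X (s n)) \<and>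
          (AE t in lebesgue_on {0<..<T}. (\<lambda>n. N (\<lambda>x. s n t x - f t x)) \<longlonglongrightarrow> 0))"

text \<open>\<open>L\<^sup>2(0,T;X)\<close> in the sense of Bochner.\<close>

definition L2_time ::
  "real \<Rightarrow> (real \<Rightarrow> real) set \<Rightarrow> ((real \<Rightarrow> real) \<Rightarrow> real) \<Rightarrow> (real \<Rightarrow> real \<Rightarrow> real) set" where
  "L2_time T X N =
     {f. (AE t in lebesgue_on {0<..<T}. f t \<in> X) \<and> strongly_measurable T X N f \<and>
         integrable (lebesgue_on {0<..<T}) (\<lambda>t. (N (f t))\<^sup>2)}"

text \<open>\<open>C([0,T];X)\<close>.\<close>

definition C_time ::
  "real \<Rightarrow> (real \<Rightarrow> real) set \<Rightarrow> ((real \<Rightarrow> real) \<Rightarrow> real) \<Rightarrow> (real \<Rightarrow> real \<Rightarrow> real) set" where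
  "C_time T X N =
     {f. (\<forall>t\<in>{0..T}. f t \<in> X) \<and>
         (\<forall>s\<in>{0..T}. ((\<lambda>t. N (\<lambda>x. f t x - f s x)) \<longlongrightarrow> 0) (at s within {0..T}))}"

text \<open>
  \<open>g\<close> is the weak derivative of \<open>f\<close> if the \<open>L\<^sup>2\<close>-valued Bochner integrals of \<open>\<phi>' f\<close> and
  \<open>- \<phi> g\<close> over \<open>(0,T)\<close> agree for every test function \<open>\<phi>\<close>.  This equality in \<open>L\<^sup>2\<close> is expressed
  by pairing with an arbitrary \<open>v\<close> in \<open>L\<^sup>2\<close>, which commutes with the Bochner integral.
\<close>

definition has_time_deriv ::
  "real \<Rightarrow> (real \<Rightarrow> real \<Rightarrow> real) \<Rightarrow> (real \<Rightarrow> real \<Rightarrow> real) \<Rightarrow> bool" where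
  "has_time_deriv T f g \<longleftrightarrow>
     (\<forall>\<phi>\<in>test_functions {0<..<T}. \<forall>v\<in>L2.
        (LINT t|lebesgue_on {0<..<T}. deriv \<phi> t * (LINT x|lebesgue_on I1. f t x * v x)) =
        - (LINT t|lebesgue_on {0<..<T}. \<phi> t * (LINT x|lebesgue_on I1. g t x * v x)))"

text \<open>\<open>H\<^sup>1(0,T;L\<^sup>2)\<close>.\<close>

definition H1_time :: "real \<Rightarrow> (real \<Rightarrow> real \<Rightarrow> real) set" where
  "H1_time T = {f \<in> L2_time T L2 L2_norm. \<exists>g\<in>L2_time T L2 L2_norm. has_time_deriv T f g}"

definition time_deriv :: "real \<Rightarrow> (real \<Rightarrow> real \<Rightarrow> real) \<Rightarrow> (real \<Rightarrow> real \<Rightarrow> real)" where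
  "time_deriv T f = (SOME g. g \<in> L2_time T L2 L2_norm \<and> has_time_deriv T f g)"

section \<open>The space \<open>\<H>(Q\<^sub>T)\<close>\<close>

definition Q :: "real \<Rightarrow> (real \<times> real) set" where
  "Q T = {0<..<T} \<times> I1"

text \<open>
  Membership in \<open>C([0,T];H\<^sup>1\<^sub>a)\<close> selects, for every \<open>t\<close> in \<open>[0,T]\<close>, the locally absolutely
  continuous representative of \<open>u(t,\<cdot>)\<close>.
\<close>

definition HQ :: "(real \<Rightarrow> real) \<Rightarrow> real \<Rightarrow> (real \<times> real \<Rightarrow> real) set" where
  "HQ a T = {u. curry u \<in> L2_time T (H2a a) (H2a_norm a) \<inter> H1_time T
                          \<inter> C_time T (H1a a) (H1a_norm a)}"

definition HQ_norm :: "(real \<Rightarrow> real) \<Rightarrow> real \<Rightarrow> (real \<times> real \<Rightarrow> real) \<Rightarrow> real" where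
  "HQ_norm a T u =
     sqrt ((SUP t\<in>{0..T}. (L2_norm (curry u t))\<^sup>2
                           + (L2_norm (\<lambda>x. sqrt (a x) * deriv (curry u t) x))\<^sup>2)
         + (LINT t|lebesgue_on {0<..<T}. (L2_norm (time_deriv T (curry u) t))\<^sup>2
                                         + (L2_norm (flux_deriv a (curry u t)))\<^sup>2))"

definition xi :: "(real \<Rightarrow> real) \<Rightarrow> real \<Rightarrow> real" where
  "xi a x = interval_lebesgue_integral lborel (ereal 0) (ereal x) (\<lambda>s. 1 / a s)"

end

(*
  Writing N for the norm of H^1_a, the Cauchy-Schwarz inequality applied to
  u(y) - u(x) = \<integral> (\<surd>a u_x) / \<surd>a over [x, y] gives |u(y) - u(x)|^2 <= N(u)^2 |xi(y) - xi(x)|.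
  Averaging over y yields the pointwise bound u(x)^2 <= N(u)^2 w(x) with w = 1 + 2|xi| + ||xi||_{L^1}.
  As \<theta> <= 2\<theta> - 1, w^\<theta> is integrable, so H^1_a embeds into L^(2\<theta>); integrate the
  2\<theta>-th power of this bound over (0,T), with N(u(t)) at most the supremum in the norm of u.
  The same pointwise bound makes u jointly continuous, hence measurable, on Q_T.
*)
theory Submission
  imports Defs
begin

text \<open>The argument is shaped by what \<open>H1a\<close> provides: an epsilon-delta condition
  over divisions and a derivative that exists almost everywhere. The fundamental theorem of calculus
  is therefore proved for the gauge integral, which yields integrability of the derivative together
  with its value. Cauchy-Schwarz is then read off from the discriminant of a quadratic polynomial
  with the integrals of a u_x^2, u_x and 1/a as coefficients, so linearity and positivity of the
  integral suffice. In time, the obstacle is that a real \<open>SUP\<close> dominates its members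
  only for a bounded family; compactness of [0,T] supplies the bound. The constant is, up to an
  added 1, the integral of w^\<theta> to the power 1 / (2 \<theta>). It involves only
  \<open>a\<close> and \<theta>, and the factor in T is the contribution of the length of the time
  interval.\<close>

section \<open>Fundamental theorem of calculus for absolutely continuous functions\<close>

text \<open>Cells tagged off \<open>E\<close> have a linearization error proportional to their
  length, as for a function differentiable everywhere. Cells tagged in \<open>E\<close> offer no
  derivative, and there the increments of \<open>f\<close> themselves must be small in
  total.\<close>

lemma abs_continuous_on_has_integral:
  fixes f f' :: "real \<Rightarrow> real"
  assumes ac: "abs_continuous_on {a..b} f" and "a \<le> b" and E: "negligible E"
    and der: "\<And>x. x \<in> {a..b} - E \<Longrightarrow> (f has_real_derivative f' x) (at x within {a..b})"
  shows "(f' has_integral f b - f a) {a..b}"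
proof -
  \<comment> \<open>With value 0 on \<open>E\<close>, a cell tagged there contributes exactly minus
    its increment of \<open>f\<close>; the change on a negligible set is undone at the end.\<close>
  define g where "g x = (if x \<in> E then 0 else f' x)" for x
  have "(g has_integral f b - f a) {a..b}"
    unfolding has_integral_real
  proof (intro allI impI)
    fix e :: real
    assume "e > 0"
    \<comment> \<open>Chosen so that \<open>\<eta> * (b - a)\<close> is at most e/2; the added 1
      keeps the denominator positive when a = b.\<close>
    define \<eta> where "\<eta> = e / (2 * (b - a + 1))"
    have "\<eta> > 0"
      using \<open>e > 0\<close> \<open>a \<le> b\<close> by (simp add: \<eta>_def)
    have "\<exists>\<delta>>0. \<forall>D. D division_of \<Union>D \<and> \<Union>D \<subseteq> {a..b} \<and> (\<Sum>K\<in>D. Sup K - Inf K) < \<delta>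
        \<longrightarrow> (\<Sum>K\<in>D. \<bar>f (Sup K) - f (Inf K)\<bar>) < e / 2"
      using ac \<open>e > 0\<close> unfolding abs_continuous_on_def by (meson half_gt_zero)
    then obtain \<delta> where "\<delta> > 0" and \<delta>: "\<And>D. D division_of \<Union>D \<Longrightarrow> \<Union>D \<subseteq> {a..b} \<Longrightarrow>
        (\<Sum>K\<in>D. Sup K - Inf K) < \<delta> \<Longrightarrow> (\<Sum>K\<in>D. \<bar>f (Sup K) - f (Inf K)\<bar>) < e / 2"
      by (elim exE conjE) blast
    obtain U where U: "open U" "E \<subseteq> U" "U - E \<in> lmeasurable"
        "emeasure lebesgue (U - E) < ennreal \<delta>"
      using sets_lebesgue_outer_open[OF negligible_imp_sets[OF E] \<open>\<delta> > 0\<close>] by metis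
    have Un: "E \<union> (U - E) = U"
      using U by auto
    have Um: "U \<in> lmeasurable"
      using fmeasurable.Un[OF negligible_imp_measurable[OF E] U(3)] by (simp only: Un)
    have "measure lebesgue (U - E) < \<delta>"
      using U(3,4) \<open>\<delta> > 0\<close> by (simp add: emeasure_eq_measure2 ennreal_less_iff)
    moreover have "measure lebesgue U \<le> measure lebesgue E + measure lebesgue (U - E)"
      using measure_Un_le[of E lebesgue "U - E"] U(3) negligible_imp_sets[OF E]
      by (simp only: Un fmeasurableD)
    ultimately have Ud: "measure lebesgue U < \<delta>"
      using E by (simp add: negligible_iff_measure)
    have "\<exists>d>0. x \<in> {a..b} - E \<longrightarrow>
        (\<forall>y\<in>{a..b}. \<bar>y - x\<bar> < d \<longrightarrow> \<bar>f y - f x - f' x * (y - x)\<bar> \<le> \<eta> * \<bar>y - x\<bar>)" for x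
      using der[of x] \<open>\<eta> > 0\<close>
      unfolding has_field_derivative_def has_derivative_within_alt
      by (cases "x \<in> {a..b} - E") (auto intro: exI[of _ 1])
    then obtain d where d0: "\<And>x. d x > 0" and d: "\<And>x y. x \<in> {a..b} - E \<Longrightarrow> y \<in> {a..b} \<Longrightarrow>
        \<bar>y - x\<bar> < d x \<Longrightarrow> \<bar>f y - f x - f' x * (y - x)\<bar> \<le> \<eta> * \<bar>y - x\<bar>"
      by metis
    \<comment> \<open>Cells tagged in \<open>E\<close> lie in \<open>U\<close>, so their total length is less than \<open>\<delta>\<close> and absolute
      continuity controls their contribution.\<close>
    define \<gamma> where "\<gamma> x = (if x \<in> E then U else ball x (d x))" for x
    show "\<exists>\<gamma>. gauge \<gamma> \<and> (\<forall>D. D tagged_division_of {a..b} \<and> \<gamma> fine D \<longrightarrow>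
        norm ((\<Sum>(x, K)\<in>D. measure lborel K *\<^sub>R g x) - (f b - f a)) < e)"
    proof (intro exI[of _ \<gamma>] conjI allI impI)
      show "gauge \<gamma>"
        using U d0 by (auto simp: gauge_def \<gamma>_def)
    next
      fix D
      assume "D tagged_division_of {a..b} \<and> \<gamma> fine D"
      then have D: "D tagged_division_of {a..b}" and fine: "\<gamma> fine D"
        by auto
      have fin: "finite D"
        using D by (rule tagged_division_ofD(1))
      have cell: "\<exists>u v. K = {u..v} \<and> u \<le> x \<and> x \<le> v \<and> a \<le> u \<and> v \<le> b \<and> K \<subseteq> \<gamma> x"
        if xK: "(x, K) \<in> D" for x K
      proof -
        obtain u v where K: "K = cbox u v"
          using tagged_division_ofD(4)[OF D xK] by auto
        moreover have "x \<in> K" "K \<subseteq> {a..b}" "K \<subseteq> \<gamma> x"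
          using tagged_division_ofD(2,3)[OF D xK] fineD[OF fine xK] by auto
        ultimately show ?thesis
          by (intro exI[of _ u] exI[of _ v]) auto
      qed
      define D1 where "D1 = {z\<in>D. fst z \<in> E}"
      define h where "h = (\<lambda>K::real set. f (Sup K) - f (Inf K))"
      have D12: "finite D1" "finite (D - D1)" "D = D1 \<union> (D - D1)"
        using fin by (auto simp: D1_def)
      have tot: "f b - f a = (\<Sum>(x,K)\<in>D. h K)" "b - a = (\<Sum>(x,K)\<in>D. Sup K - Inf K)"
        using additive_tagged_division_1[OF \<open>a \<le> b\<close> D, of f]
          additive_tagged_division_1[OF \<open>a \<le> b\<close> D, of "\<lambda>x. x"]
        by (simp_all add: h_def)
      have part: "D1 tagged_partial_division_of {a..b}"
        using D by (auto simp: D1_def tagged_division_of_def intro: tagged_partial_division_subset)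
      have tag: "D1 tagged_division_of \<Union>(snd ` D1)"
        by (rule tagged_partial_division_of_Union_self[OF part])
      have div: "snd ` D1 division_of \<Union>(snd ` D1)"
        by (rule division_of_tagged_division[OF tag])
      have sub: "\<Union>(snd ` D1) \<subseteq> {a..b}"
        using cell by (fastforce simp: D1_def)
      have subU: "\<Union>(snd ` D1) \<subseteq> U"
        using cell by (fastforce simp: D1_def \<gamma>_def)
      have len: "(\<Sum>K\<in>snd ` D1. Sup K - Inf K) = (\<Sum>K\<in>snd ` D1. measure lebesgue K)"
        using cell by (intro sum.cong) (force simp: D1_def)+
      have "\<dots> = measure lebesgue (\<Union>(snd ` D1))"
        by (rule content_division[OF div])
      also have "\<dots> \<le> measure lebesgue U"
        using subU Um lmeasurable_division[OF div]
        by (intro measure_mono_fmeasurable) (auto simp: fmeasurableD)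
      finally have small: "(\<Sum>K\<in>snd ` D1. \<bar>h K\<bar>) < e / 2"
        unfolding h_def using Ud len by (intro \<delta> div sub) simp
      have inj: "(\<Sum>(x,K)\<in>D1. \<bar>h K\<bar>) = (\<Sum>K\<in>snd ` D1. \<bar>h K\<bar>)"
      proof -
        \<comment> \<open>Two tags can share a cell only if its interior is empty, and such a cell
          must have weight 0 for the sums over pairs and over cells to agree. For a singleton
          \<open>h\<close> vanishes, but \<open>h {}\<close> involves unspecified values of
          \<open>Sup\<close> and \<open>Inf\<close>, hence the default 0.\<close>
        define h' where "h' K = (if K = {} then 0 else \<bar>h K\<bar>)" for K
        have "(\<Sum>(x,K)\<in>D1. \<bar>h K\<bar>) = (\<Sum>(x,K)\<in>D1. h' K)"
          using cell by (intro sum.cong) (fastforce simp: D1_def h'_def)+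
        also have "\<dots> = (\<Sum>K\<in>snd ` D1. h' K)"
          by (intro sum.over_tagged_division_lemma[OF tag]) (auto simp: h'_def h_def)
        also have "\<dots> = (\<Sum>K\<in>snd ` D1. \<bar>h K\<bar>)"
          using cell by (intro sum.cong) (fastforce simp: D1_def h'_def)+
        finally show ?thesis .
      qed
      have A: "\<bar>\<Sum>(x,K)\<in>D1. measure lborel K *\<^sub>R g x - h K\<bar> < e / 2"
      proof -
        have "(\<Sum>(x,K)\<in>D1. measure lborel K *\<^sub>R g x - h K) = (\<Sum>(x,K)\<in>D1. - h K)"
          by (intro sum.cong) (auto simp: D1_def g_def)
        also have "\<bar>\<dots>\<bar> \<le> (\<Sum>(x,K)\<in>D1. \<bar>h K\<bar>)"
          by (rule order_trans[OF sum_abs]) (auto intro!: sum_mono)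
        finally show ?thesis
          using small inj by simp
      qed
      have B: "\<bar>\<Sum>(x,K)\<in>D - D1. measure lborel K *\<^sub>R g x - h K\<bar> \<le> e / 2"
      proof -
        have *: "\<bar>measure lborel K *\<^sub>R g x - h K\<bar> \<le> \<eta> * (Sup K - Inf K)" if "(x, K) \<in> D - D1" for x K
        proof -
          from that have xK: "(x, K) \<in> D" and xE: "x \<notin> E"
            by (auto simp: D1_def)
          obtain u v where uv: "K = {u..v}" "u \<le> x" "x \<le> v" "a \<le> u" "v \<le> b" "K \<subseteq> \<gamma> x"
            using cell[OF xK] by auto
          have "u \<in> \<gamma> x" "v \<in> \<gamma> x"
            using uv by auto
          then have "\<bar>u - x\<bar> < d x" "\<bar>v - x\<bar> < d x"
            using xE by (auto simp: \<gamma>_def dist_real_def)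
          then have "\<bar>f u - f x - f' x * (u - x)\<bar> \<le> \<eta> * \<bar>u - x\<bar>"
              "\<bar>f v - f x - f' x * (v - x)\<bar> \<le> \<eta> * \<bar>v - x\<bar>"
            using d[of x u] d[of x v] uv xE by (force, force)
          \<comment> \<open>The tag lies between u and v, so the two errors add up to \<eta> times
            (x - u) + (v - x) = v - u.\<close>
          then have "\<bar>(v - u) * f' x - (f v - f u)\<bar> \<le> \<eta> * (v - u)"
            using uv by (simp add: algebra_simps abs_if split: if_splits)
          then show ?thesis
            using uv xE by (simp add: g_def h_def)
        qed
        have "\<bar>\<Sum>(x,K)\<in>D - D1. measure lborel K *\<^sub>R g x - h K\<bar>
            \<le> (\<Sum>(x,K)\<in>D - D1. \<eta> * (Sup K - Inf K))"
          by (rule order_trans[OF sum_abs]) (use * in \<open>auto intro!: sum_mono\<close>)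
        also have "\<dots> \<le> (\<Sum>(x,K)\<in>D. \<eta> * (Sup K - Inf K))"
          using cell \<open>\<eta> > 0\<close> fin by (intro sum_mono2) (auto, fastforce)
        also have "\<dots> = \<eta> * (b - a)"
          by (simp add: tot(2) sum_distrib_left case_prod_unfold)
        also have "\<dots> \<le> e / 2"
          using \<open>a \<le> b\<close> \<open>e > 0\<close> by (simp add: \<eta>_def field_simps)
        finally show ?thesis .
      qed
      have "(\<Sum>(x,K)\<in>D. measure lborel K *\<^sub>R g x) - (f b - f a) = (\<Sum>(x,K)\<in>D. measure lborel K *\<^sub>R g x - h K)"
        by (simp add: tot(1) case_prod_unfold sum_subtractf)
      also have "\<dots> = (\<Sum>(x,K)\<in>D1. measure lborel K *\<^sub>R g x - h K)
          + (\<Sum>(x,K)\<in>D - D1. measure lborel K *\<^sub>R g x - h K)"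
        by (subst D12(3), rule sum.union_disjoint) (use D12 in auto)
      finally show "norm ((\<Sum>(x,K)\<in>D. measure lborel K *\<^sub>R g x) - (f b - f a)) < e"
        using A B by (simp only: real_norm_def)
    qed
  qed
  then show ?thesis
    using E by (rule has_integral_spike[rotated 2]) (auto simp: g_def)
qed

section \<open>Square-integrable functions and the weighted space\<close>

lemma mem_L2_iff:
  "f \<in> L2 \<longleftrightarrow> f \<in> borel_measurable (lebesgue_on I1) \<and> integrable (lebesgue_on I1) (\<lambda>x. (f x)\<^sup>2)"
  by (simp add: Lp_def)

lemma L2_norm_sq: "(L2_norm f)\<^sup>2 = (LINT x|lebesgue_on I1. (f x)\<^sup>2)"
proof -
  have "(LINT x|lebesgue_on I1. (f x)\<^sup>2) \<ge> 0"
    by (rule Bochner_Integration.integral_nonneg) simp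
  then show ?thesis
    by (simp add: Lp_norm_def powr_half_sqrt)
qed

lemma L2_diff:
  assumes "f \<in> L2" "g \<in> L2"
  shows "(\<lambda>x. f x - g x) \<in> L2"
proof -
  have [measurable]: "f \<in> borel_measurable (lebesgue_on I1)" "g \<in> borel_measurable (lebesgue_on I1)"
    using assms by (auto simp: mem_L2_iff)
  have "integrable (lebesgue_on I1) (\<lambda>x. (f x - g x)\<^sup>2)"
  proof (rule Bochner_Integration.integrable_bound)
    show "integrable (lebesgue_on I1) (\<lambda>x. 2 * (f x)\<^sup>2 + 2 * (g x)\<^sup>2)"
      using assms by (auto simp: mem_L2_iff)
    have "(f x - g x)\<^sup>2 \<le> 2 * (f x)\<^sup>2 + 2 * (g x)\<^sup>2" for x
      using zero_le_power2[of "f x + g x"] by (simp add: power2_eq_square algebra_simps)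
    then show "AE x in lebesgue_on I1. norm ((f x - g x)\<^sup>2) \<le> norm (2 * (f x)\<^sup>2 + 2 * (g x)\<^sup>2)"
      by auto
  qed measurable
  then show ?thesis
    by (simp add: mem_L2_iff)
qed

text \<open>A triangle inequality for squares with factor 2: pointwise, the right side minus the
  left side is (f - 2 g)^2. This crude form is all that the boundedness in time calls for.\<close>

lemma L2_norm_sq_le_diff:
  assumes "f \<in> L2" "g \<in> L2"
  shows "(L2_norm f)\<^sup>2 \<le> 2 * (L2_norm (\<lambda>x. f x - g x))\<^sup>2 + 2 * (L2_norm g)\<^sup>2"
proof -
  have int: "integrable (lebesgue_on I1) (\<lambda>x. (f x)\<^sup>2)"
      "integrable (lebesgue_on I1) (\<lambda>x. (g x)\<^sup>2)"
      "integrable (lebesgue_on I1) (\<lambda>x. (f x - g x)\<^sup>2)"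
    using assms L2_diff[OF assms] by (auto simp: mem_L2_iff)
  have "(f x)\<^sup>2 \<le> 2 * (f x - g x)\<^sup>2 + 2 * (g x)\<^sup>2" for x
    using zero_le_power2[of "f x - 2 * g x"] by (simp add: power2_eq_square algebra_simps)
  then have "(LINT x|lebesgue_on I1. (f x)\<^sup>2)
      \<le> (LINT x|lebesgue_on I1. 2 * (f x - g x)\<^sup>2 + 2 * (g x)\<^sup>2)"
    using int by (intro integral_mono) auto
  then show ?thesis
    using int by (simp add: L2_norm_sq)
qed

text \<open>\<open>deriv\<close> of a difference splits only almost everywhere, so membership in
  \<open>L2\<close> must survive changes on null sets. Measurability does because Lebesgue measure
  is complete; extension by zero carries the question to the whole line.\<close>

lemma L2_cong_AE:
  assumes fg: "AE x in lebesgue_on I1. f x = g x" and f: "f \<in> L2"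
  shows "g \<in> L2" "L2_norm f = L2_norm g"
proof -
  have fm: "f \<in> borel_measurable (lebesgue_on I1)"
    using f by (simp add: mem_L2_iff)
  have gm: "g \<in> borel_measurable (lebesgue_on I1)"
  proof -
    have "AE x in lebesgue. (if x \<in> I1 then f x else 0) = (if x \<in> I1 then g x else 0)"
      using fg by (subst (asm) AE_restrict_space_iff) auto
    moreover have "(\<lambda>x. if x \<in> I1 then f x else 0) \<in> borel_measurable lebesgue"
      using fm by (intro borel_measurable_if_I) auto
    ultimately have "(\<lambda>x. if x \<in> I1 then g x else 0) \<in> borel_measurable lebesgue"
      by (rule borel_measurable_AE[rotated])
    then show ?thesis
      by (rule borel_measurable_if_D)
  qed
  have sq: "AE x in lebesgue_on I1. (f x)\<^sup>2 = (g x)\<^sup>2"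
    using fg by eventually_elim simp
  show "g \<in> L2"
    using f fm gm integrable_cong_AE[OF _ _ sq] by (auto simp: mem_L2_iff)
  have "(L2_norm f)\<^sup>2 = (L2_norm g)\<^sup>2"
    unfolding L2_norm_sq using fm gm sq by (intro integral_cong_AE) auto
  then show "L2_norm f = L2_norm g"
    by (simp add: Lp_norm_def)
qed

lemma abs_continuous_on_diff:
  assumes "abs_continuous_on S f" "abs_continuous_on S g"
  shows "abs_continuous_on S (\<lambda>x. f x - g x)"
  unfolding abs_continuous_on_def
proof (intro allI impI)
  fix e :: real
  assume "e > 0"
  then have "e / 2 > 0"
    by simp
  obtain d1 where "d1 > 0"
    and d1: "\<forall>D. D division_of \<Union>D \<and> \<Union>D \<subseteq> S \<and> (\<Sum>K\<in>D. Sup K - Inf K) < d1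
        \<longrightarrow> (\<Sum>K\<in>D. \<bar>f (Sup K) - f (Inf K)\<bar>) < e / 2"
    using assms(1)[unfolded abs_continuous_on_def, rule_format, OF \<open>e / 2 > 0\<close>] by auto
  obtain d2 where "d2 > 0"
    and d2: "\<forall>D. D division_of \<Union>D \<and> \<Union>D \<subseteq> S \<and> (\<Sum>K\<in>D. Sup K - Inf K) < d2
        \<longrightarrow> (\<Sum>K\<in>D. \<bar>g (Sup K) - g (Inf K)\<bar>) < e / 2"
    using assms(2)[unfolded abs_continuous_on_def, rule_format, OF \<open>e / 2 > 0\<close>] by auto
  show "\<exists>d>0. \<forall>D. D division_of \<Union>D \<and> \<Union>D \<subseteq> S \<and> (\<Sum>K\<in>D. Sup K - Inf K) < d
        \<longrightarrow> (\<Sum>K\<in>D. \<bar>(f (Sup K) - g (Sup K)) - (f (Inf K) - g (Inf K))\<bar>) < e"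
  proof (intro exI[of _ "min d1 d2"] conjI allI impI)
    fix D
    assume D: "D division_of \<Union>D \<and> \<Union>D \<subseteq> S \<and> (\<Sum>K\<in>D. Sup K - Inf K) < min d1 d2"
    have "(\<Sum>K\<in>D. \<bar>(f (Sup K) - g (Sup K)) - (f (Inf K) - g (Inf K))\<bar>)
        \<le> (\<Sum>K\<in>D. \<bar>f (Sup K) - f (Inf K)\<bar> + \<bar>g (Sup K) - g (Inf K)\<bar>)"
      by (intro sum_mono) auto
    also have "\<dots> = (\<Sum>K\<in>D. \<bar>f (Sup K) - f (Inf K)\<bar>) + (\<Sum>K\<in>D. \<bar>g (Sup K) - g (Inf K)\<bar>)"
      by (rule sum.distrib)
    also have "\<dots> < e / 2 + e / 2"
      using D d1[rule_format, of D] d2[rule_format, of D] by linarith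
    finally show "(\<Sum>K\<in>D. \<bar>(f (Sup K) - g (Sup K)) - (f (Inf K) - g (Inf K))\<bar>) < e"
      by simp
  qed (use \<open>d1 > 0\<close> \<open>d2 > 0\<close> in auto)
qed

text \<open>The interval spanned by two points is by itself a division with a single cell.\<close>

lemma abs_continuous_on_imp_continuous_on:
  assumes "abs_continuous_on {\<alpha>..\<beta>} f"
  shows "continuous_on {\<alpha>..\<beta>} f"
  unfolding continuous_on_iff
proof (intro ballI allI impI)
  fix x e :: real
  assume x: "x \<in> {\<alpha>..\<beta>}" and "e > 0"
  with assms obtain d where "d > 0"
    and d: "\<forall>D. D division_of \<Union>D \<and> \<Union>D \<subseteq> {\<alpha>..\<beta>} \<and> (\<Sum>K\<in>D. Sup K - Inf K) < d
        \<longrightarrow> (\<Sum>K\<in>D. \<bar>f (Sup K) - f (Inf K)\<bar>) < e"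
    unfolding abs_continuous_on_def by blast
  show "\<exists>d>0. \<forall>y\<in>{\<alpha>..\<beta>}. dist y x < d \<longrightarrow> dist (f y) (f x) < e"
  proof (intro exI[of _ d] conjI ballI impI)
    fix y
    assume y: "y \<in> {\<alpha>..\<beta>}" "dist y x < d"
    have "{{min x y..max x y}} division_of {min x y..max x y}"
      using division_of_self[of "min x y" "max x y"] by simp
    then have "\<bar>f (max x y) - f (min x y)\<bar> < e"
      using d[rule_format, of "{{min x y..max x y}}"] x y
      by (auto simp: dist_real_def max_def min_def split: if_splits)
    then show "dist (f y) (f x) < e"
      by (auto simp: dist_real_def max_def min_def split: if_splits)
  qed fact
qed

lemma H1aD:
  assumes "u \<in> H1a a"
  shows "u \<in> L2" "locally_abs_continuous_on I1 u"
    "AE x in lebesgue_on I1. u differentiable (at x)"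
    "(\<lambda>x. sqrt (a x) * deriv u x) \<in> L2"
  using assms by (auto simp: H1a_def)

lemma AE_deriv_diff:
  assumes "AE x in M. f differentiable (at x)" "AE x in M. g differentiable (at x)"
  shows "AE x in M. deriv (\<lambda>x. f x - g x) x = deriv f x - (deriv g x :: real)"
  using assms by eventually_elim (simp add: field_differentiable_def real_differentiable_def)

lemma H1a_diff:
  assumes u: "u \<in> H1a a" and v: "v \<in> H1a a"
  shows "(\<lambda>x. u x - v x) \<in> H1a a"
    and "L2_norm (\<lambda>x. sqrt (a x) * deriv (\<lambda>x. u x - v x) x)
       = L2_norm (\<lambda>x. sqrt (a x) * deriv u x - sqrt (a x) * deriv v x)"
proof -
  have ae: "AE x in lebesgue_on I1. sqrt (a x) * deriv u x - sqrt (a x) * deriv v x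
      = sqrt (a x) * deriv (\<lambda>x. u x - v x) x"
    using AE_deriv_diff[OF H1aD(3)[OF u] H1aD(3)[OF v]]
    by eventually_elim (simp add: right_diff_distrib)
  note D = L2_cong_AE[OF ae L2_diff[OF H1aD(4)[OF u] H1aD(4)[OF v]]]
  show "L2_norm (\<lambda>x. sqrt (a x) * deriv (\<lambda>x. u x - v x) x)
       = L2_norm (\<lambda>x. sqrt (a x) * deriv u x - sqrt (a x) * deriv v x)"
    using D(2) by simp
  have "AE x in lebesgue_on I1. (\<lambda>x. u x - v x) differentiable (at x)"
    using H1aD(3)[OF u] H1aD(3)[OF v] by eventually_elim auto
  moreover have "locally_abs_continuous_on I1 (\<lambda>x. u x - v x)"
    using H1aD(2)[OF u] H1aD(2)[OF v]
    by (auto simp: locally_abs_continuous_on_def intro: abs_continuous_on_diff)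
  ultimately show "(\<lambda>x. u x - v x) \<in> H1a a"
    using D(1) L2_diff[OF H1aD(1)[OF u] H1aD(1)[OF v]] by (simp add: H1a_def)
qed

lemma H1a_norm_sq:
  "(H1a_norm a u)\<^sup>2 = (L2_norm u)\<^sup>2 + (L2_norm (\<lambda>x. sqrt (a x) * deriv u x))\<^sup>2"
  by (simp add: H1a_norm_def)

lemma H1a_norm_sq_le_diff:
  assumes u: "u \<in> H1a a" and v: "v \<in> H1a a"
  shows "(H1a_norm a u)\<^sup>2 \<le> 2 * (H1a_norm a (\<lambda>x. u x - v x))\<^sup>2 + 2 * (H1a_norm a v)\<^sup>2"
  using L2_norm_sq_le_diff[OF H1aD(1)[OF u] H1aD(1)[OF v]]
    L2_norm_sq_le_diff[OF H1aD(4)[OF u] H1aD(4)[OF v]]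
  by (simp add: H1a_norm_sq H1a_diff(2)[OF u v])

section \<open>Discriminant inequality, the weight, and continuity of slices\<close>

text \<open>A polynomial in c without negative values has nonpositive discriminant. For J > 0 it is
  evaluated at its minimizer d / J; for J = 0 it is affine, which forces d = 0.\<close>

lemma quadratic_discriminant_le:
  fixes A d J :: real
  assumes "J \<ge> 0" and quad: "\<And>c. 0 \<le> A - 2 * c * d + c\<^sup>2 * J"
  shows "d\<^sup>2 \<le> A * J"
proof (cases "J = 0")
  case True
  have "d = 0"
  proof (rule ccontr)
    assume "d \<noteq> 0"
    \<comment> \<open>At c = (A + 1) / d the value is -A - 2, negative because c = 0 gives A \<ge>
      0.\<close>
    then show False
      using quad[of "(A + 1) / d"] quad[of 0] True by simp
  qed
  then show ?thesis
    using True by simp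
next
  case False
  then show ?thesis
    using \<open>J \<ge> 0\<close> quad[of "d / J"] by (simp add: field_simps power2_eq_square)
qed

definition sup_weight :: "(real \<Rightarrow> real) \<Rightarrow> real \<Rightarrow> real" where
  "sup_weight a x = 1 + 2 * \<bar>xi a x\<bar> + (LINT y|lebesgue_on I1. \<bar>xi a y\<bar>)"

lemma sup_weight_ge_1: "sup_weight a x \<ge> 1"
proof -
  have "(LINT y|lebesgue_on I1. \<bar>xi a y\<bar>) \<ge> 0"
    by (rule Bochner_Integration.integral_nonneg) simp
  then show ?thesis
    by (simp add: sup_weight_def)
qed

lemma H1a_imp_continuous_on:
  assumes "u \<in> H1a a"
  shows "continuous_on I1 u"
proof -
  have "isCont u x" if "x \<in> I1" for x
  proof -
    \<comment> \<open>The midpoint of \<bar>x\<bar> and 1, so that x is interior to [-r, r] and this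
      interval stays inside (-1, 1).\<close>
    define r where "r = (1 + \<bar>x\<bar>) / 2"
    have r: "-r < x" "x < r" "r < 1"
      using that by (auto simp: r_def abs_if field_simps)
    then have "{-r..r} \<subseteq> I1"
      by auto
    then have "continuous_on {-r..r} u"
      using H1aD(2)[OF assms]
      by (intro abs_continuous_on_imp_continuous_on) (simp add: locally_abs_continuous_on_def)
    then show ?thesis
      using r by (intro continuous_on_interior[of "{-r..r}"]) auto
  qed
  then show ?thesis
    by (simp add: continuous_at_imp_continuous_on)
qed

lemma H1a_norm_zero [simp]: "H1a_norm a (\<lambda>x. 0) = 0"
  by (simp add: H1a_norm_def Lp_norm_def)

lemma H1a_norm_nonneg [simp]: "H1a_norm a u \<ge> 0"
  by (simp add: H1a_norm_def)

section \<open>Boundedness in time\<close>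

text \<open>Each time s has a neighbourhood on which the norm of \<open>f t - f s\<close> is below
  1, and finitely many of these cover [0,T]. This is what makes the \<open>SUP\<close> in
  \<open>HQ_norm\<close> an actual upper bound.\<close>

lemma C_time_H1a_bdd:
  assumes f: "f \<in> C_time T (H1a a) (H1a_norm a)"
  shows "bdd_above ((\<lambda>t. (H1a_norm a (f t))\<^sup>2) ` {0..T})"
proof -
  have mem: "f t \<in> H1a a" if "t \<in> {0..T}" for t
    using f that by (auto simp: C_time_def)
  have "\<exists>U. open U \<and> s \<in> U \<and> (\<forall>t\<in>U \<inter> {0..T}. H1a_norm a (\<lambda>x. f t x - f s x) < 1)"
    if s: "s \<in> {0..T}" for s
  proof -
    have "((\<lambda>t. H1a_norm a (\<lambda>x. f t x - f s x)) \<longlongrightarrow> 0) (at s within {0..T})"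
      using f s by (auto simp: C_time_def)
    then have "\<forall>\<^sub>F t in at s within {0..T}. H1a_norm a (\<lambda>x. f t x - f s x) < 1"
      by (rule order_tendstoD) simp
    then obtain U where U: "open U" "s \<in> U"
        "\<forall>t\<in>U. t \<noteq> s \<longrightarrow> t \<in> {0..T} \<longrightarrow> H1a_norm a (\<lambda>x. f t x - f s x) < 1"
      by (auto simp: eventually_at_topological)
    \<comment> \<open>The limit says nothing at t = s, where the difference is zero anyway.\<close>
    have "H1a_norm a (\<lambda>x. f t x - f s x) < 1" if "t \<in> U \<inter> {0..T}" for t
      using U(3) that by (cases "t = s") auto
    with U show ?thesis
      by blast
  qed
  then obtain U where U: "\<And>s. s \<in> {0..T} \<Longrightarrow> open (U s)" "\<And>s. s \<in> {0..T} \<Longrightarrow> s \<in> U s"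
    and U1: "\<And>s t. s \<in> {0..T} \<Longrightarrow> t \<in> U s \<Longrightarrow> t \<in> {0..T} \<Longrightarrow> H1a_norm a (\<lambda>x. f t x - f s x) < 1"
    by (metis IntI)
  obtain F where F: "F \<subseteq> {0..T}" "finite F" "{0..T} \<subseteq> (\<Union>s\<in>F. U s)"
    by (rule compactE_image[of "{0..T}" "{0..T}" U]) (use U in auto)
  have "(H1a_norm a (f t))\<^sup>2 \<le> 2 + (\<Sum>s\<in>F. 2 * (H1a_norm a (f s))\<^sup>2)" if t: "t \<in> {0..T}" for t
  proof -
    obtain s where s: "s \<in> F" "t \<in> U s"
      using F t by auto
    then have "s \<in> {0..T}"
      using F by auto
    then have "H1a_norm a (\<lambda>x. f t x - f s x) \<le> 1"
      using U1[of s t] s t by simp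
    then have "(H1a_norm a (\<lambda>x. f t x - f s x))\<^sup>2 \<le> 1"
      by (simp add: power_le_one)
    then have "(H1a_norm a (f t))\<^sup>2 \<le> 2 + 2 * (H1a_norm a (f s))\<^sup>2"
      using H1a_norm_sq_le_diff[OF mem[OF t] mem[OF \<open>s \<in> {0..T}\<close>]] by linarith
    also have "\<dots> \<le> 2 + (\<Sum>s\<in>F. 2 * (H1a_norm a (f s))\<^sup>2)"
      using member_le_sum[of s F "\<lambda>s. 2 * (H1a_norm a (f s))\<^sup>2"] s F by simp
    finally show ?thesis .
  qed
  then show ?thesis
    by (rule bdd_aboveI2)
qed

lemma H1a_norm_le_HQ_norm:
  assumes u: "u \<in> HQ a T" and t: "t \<in> {0..T}"
  shows "H1a_norm a (curry u t) \<le> HQ_norm a T u"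
proof -
  have "bdd_above ((\<lambda>t. (H1a_norm a (curry u t))\<^sup>2) ` {0..T})"
    using u by (intro C_time_H1a_bdd) (auto simp: HQ_def)
  then have "(H1a_norm a (curry u t))\<^sup>2 \<le> (SUP t\<in>{0..T}. (H1a_norm a (curry u t))\<^sup>2)"
    using t by (rule cSUP_upper[rotated])
  also have "\<dots> \<le> (SUP t\<in>{0..T}. (H1a_norm a (curry u t))\<^sup>2)
      + (LINT t|lebesgue_on {0<..<T}. (L2_norm (time_deriv T (curry u) t))\<^sup>2
                                         + (L2_norm (flux_deriv a (curry u t)))\<^sup>2)"
    by (simp add: Bochner_Integration.integral_nonneg)
  finally show ?thesis
    unfolding HQ_norm_def H1a_norm_sq[symmetric] by (rule real_le_rsqrt)
qed

section \<open>Integrability of the weight and integration over \<open>Q T\<close>\<close>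

text \<open>The interval has finite measure, so the exponent \<open>2 * \<theta> - 1\<close> can be
  lowered to 1. This first conclusion makes the L^1 term inside \<open>sup_weight\<close> a genuine
  integral.\<close>

lemma integrable_sup_weight_powr:
  assumes "\<theta> \<ge> 1" and "xi a \<in> Lp (2 * \<theta> - 1) (lebesgue_on I1)"
  shows "integrable (lebesgue_on I1) (xi a)"
    and "integrable (lebesgue_on I1) (\<lambda>x. sup_weight a x powr \<theta>)"
proof -
  have meas: "xi a \<in> borel_measurable (lebesgue_on I1)"
    and int: "integrable (lebesgue_on I1) (\<lambda>x. \<bar>xi a x\<bar> powr (2 * \<theta> - 1))"
    using assms by (auto simp: Lp_def)
  have one: "integrable (lebesgue_on I1) (\<lambda>y. c :: real)" for c
    using finite_measure.integrable_const[OF finite_measure_lebesgue_on, of I1] by simp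
  show "integrable (lebesgue_on I1) (xi a)"
  proof (rule Bochner_Integration.integrable_bound[OF Bochner_Integration.integrable_add[OF one[of 1] int] meas])
    have "s \<le> 1 + s powr (2 * \<theta> - 1)" if "s \<ge> 0" for s :: real
    proof (cases "s \<le> 1")
      case False
      then show ?thesis
        using powr_mono[of 1 "2 * \<theta> - 1" s] \<open>\<theta> \<ge> 1\<close> by simp
    qed (use powr_ge_zero[of s "2 * \<theta> - 1"] in linarith)
    then show "AE x in lebesgue_on I1. norm (xi a x) \<le> norm (1 + \<bar>xi a x\<bar> powr (2 * \<theta> - 1))"
      by (auto simp: abs_of_nonneg add_nonneg_nonneg)
  qed
  define c where "c = 1 + (LINT y|lebesgue_on I1. \<bar>xi a y\<bar>)"
  have w: "sup_weight a x = c + 2 * \<bar>xi a x\<bar>" for x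
    by (simp add: sup_weight_def c_def)
  show "integrable (lebesgue_on I1) (\<lambda>x. sup_weight a x powr \<theta>)"
  proof (rule Bochner_Integration.integrable_bound)
    \<comment> \<open>The constants 2 c and 4 come from c + 2 \<bar>xi\<bar> \<le> max (2 c) (4
      \<bar>xi\<bar>); a power of a maximum is at most the sum of the powers.\<close>
    show "integrable (lebesgue_on I1) (\<lambda>x. (2 * c) powr (2 * \<theta> - 1) + 4 powr (2 * \<theta> - 1) * \<bar>xi a x\<bar> powr (2 * \<theta> - 1))"
      using one int by auto
    show "(\<lambda>x. sup_weight a x powr \<theta>) \<in> borel_measurable (lebesgue_on I1)"
      using meas unfolding w by measurable
    have "sup_weight a x powr \<theta> \<le> (2 * c) powr (2 * \<theta> - 1) + 4 powr (2 * \<theta> - 1) * \<bar>xi a x\<bar> powr (2 * \<theta> - 1)" for x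
    proof -
      have w1: "1 \<le> sup_weight a x"
        by (rule sup_weight_ge_1)
      then have "sup_weight a x powr \<theta> \<le> sup_weight a x powr (2 * \<theta> - 1)"
        using \<open>\<theta> \<ge> 1\<close> by (intro powr_mono) auto
      also have "\<dots> \<le> max (2 * c) (4 * \<bar>xi a x\<bar>) powr (2 * \<theta> - 1)"
        using w1 \<open>\<theta> \<ge> 1\<close> by (intro powr_mono2) (auto simp: w)
      also have "\<dots> \<le> (2 * c) powr (2 * \<theta> - 1) + (4 * \<bar>xi a x\<bar>) powr (2 * \<theta> - 1)"
        by (simp add: max_def)
      finally show ?thesis
        by (simp add: powr_mult)
    qed
    then show "AE x in lebesgue_on I1. norm (sup_weight a x powr \<theta>)
        \<le> norm ((2 * c) powr (2 * \<theta> - 1) + 4 powr (2 * \<theta> - 1) * \<bar>xi a x\<bar> powr (2 * \<theta> - 1))"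
      by (auto simp: abs_of_nonneg add_nonneg_nonneg)
  qed
qed

text \<open>Lebesgue measure on the plane is the completion of a product rather than a product, so
  Tonelli is applied to \<open>lborel\<close>. Hence \<open>g\<close> is taken Borel on the whole
  plane and zero outside \<open>Q T\<close>.\<close>

lemma integral_Q_le:
  fixes g :: "real \<times> real \<Rightarrow> real"
  assumes [measurable]: "g \<in> borel_measurable borel"
    and g0: "\<And>z. g z \<ge> 0" and T: "T > 0"
    and supp: "\<And>z. z \<notin> Q T \<Longrightarrow> g z = 0"
    and bound: "\<And>t x. t \<in> {0<..<T} \<Longrightarrow> x \<in> I1 \<Longrightarrow> g (t, x) \<le> w x"
    and w: "integrable (lebesgue_on I1) w" "\<And>x. w x \<ge> 0"
  shows "integrable lborel g" "integral\<^sup>L lborel g \<le> T * (LINT x|lebesgue_on I1. w x)"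
proof -
  define C where "C = (LINT x|lebesgue_on I1. w x)"
  have C0: "C \<ge> 0"
    unfolding C_def using w by (intro Bochner_Integration.integral_nonneg)
  have inner: "(\<integral>\<^sup>+x. g (t, x) \<partial>lborel) \<le> ennreal C * indicator {0<..<T} t" for t
  proof (cases "t \<in> {0<..<T}")
    \<comment> \<open>As \<open>w\<close> is only Lebesgue measurable, the inner integral passes to
      the completed measure before the comparison.\<close>
    case True
    have "(\<integral>\<^sup>+x. g (t, x) \<partial>lborel) = (\<integral>\<^sup>+x. g (t, x) \<partial>lebesgue)"
      by (rule nn_integral_completion[symmetric])
    also have "\<dots> \<le> (\<integral>\<^sup>+x. ennreal (w x) * indicator I1 x \<partial>lebesgue)"
      using bound[OF True] supp[of "(t, _)"]
      by (intro nn_integral_mono) (auto simp: Q_def indicator_def intro!: ennreal_leI)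
    also have "\<dots> = (\<integral>\<^sup>+x. ennreal (w x) \<partial>lebesgue_on I1)"
      by (rule nn_integral_restrict_space[symmetric]) simp
    also have "\<dots> = ennreal C"
      unfolding C_def using w by (intro nn_integral_eq_integral) auto
    finally show ?thesis
      using True by simp
  next
    case False
    then have "g (t, x) = 0" for x
      by (intro supp) (auto simp: Q_def)
    then show ?thesis
      by simp
  qed
  have "(\<integral>\<^sup>+z. g z \<partial>lborel) = (\<integral>\<^sup>+z. g z \<partial>(lborel \<Otimes>\<^sub>M lborel))"
    by (simp add: lborel_prod)
  also have "\<dots> = (\<integral>\<^sup>+t. (\<integral>\<^sup>+x. g (t, x) \<partial>lborel) \<partial>lborel)"
    by (rule lborel.nn_integral_fst[symmetric]) (simp add: lborel_prod)
  also have "\<dots> \<le> (\<integral>\<^sup>+t. ennreal C * indicator {0<..<T} t \<partial>lborel)"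
    by (rule nn_integral_mono) (rule inner)
  also have "\<dots> = ennreal (T * C)"
    using T C0 by (simp add: nn_integral_cmult_indicator ennreal_mult' mult.commute)
  finally have le: "(\<integral>\<^sup>+z. g z \<partial>lborel) \<le> ennreal (T * C)" .
  show int: "integrable lborel g"
    using le g0 by (intro integrableI_nonneg) (auto simp: less_top[symmetric] top_unique)
  have "ennreal (integral\<^sup>L lborel g) \<le> ennreal (T * C)"
    using le nn_integral_eq_integral[OF int] g0 by simp
  then show "integral\<^sup>L lborel g \<le> T * (LINT x|lebesgue_on I1. w x)"
    using T C0 by (simp add: C_def)
qed

section \<open>Pointwise estimates in the weighted space\<close>

context
  fixes a :: "real \<Rightarrow> real"
  assumes cont: "continuous_on I1 a" and pos: "\<forall>x\<in>I1. a x > 0"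
begin

text \<open>The integral defining \<open>xi\<close> is oriented, so additivity over 0, x and y
  covers every position of 0. The result is stated for the gauge integral to match that of the
  derivative in \<open>H1a_increment\<close>.\<close>

lemma has_integral_inverse_weight:
  assumes "-1 < x" "x \<le> y" "y < 1"
  shows "((\<lambda>s. 1 / a s) has_integral xi a y - xi a x) {x..y}"
proof -
  have inv: "continuous_on {\<alpha>..\<beta>} (\<lambda>s. 1 / a s)" if "-1 < \<alpha>" "\<beta> < 1" for \<alpha> \<beta>
  proof (rule continuous_on_divide[OF continuous_on_const continuous_on_subset[OF cont]])
    show sub: "{\<alpha>..\<beta>} \<subseteq> I1"
      using that by auto
    show "\<forall>s\<in>{\<alpha>..\<beta>}. a s \<noteq> 0"
      using sub pos by (metis less_irrefl subsetD)
  qed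
  have int: "set_integrable lborel {\<alpha>..\<beta>} (\<lambda>s. 1 / a s)" if "-1 < \<alpha>" "\<beta> < 1" for \<alpha> \<beta>
    by (rule borel_integrable_atLeastAtMost'[OF inv[OF that]])
  \<comment> \<open>[l, r] is the hull of 0, x and y; it is a compact part of (-1, 1), so 1/a is
    continuous and integrable on it.\<close>
  define l where "l = min 0 x"
  define r where "r = max 0 y"
  have lr: "-1 < l" "r < 1" "l \<le> r"
    using assms by (auto simp: l_def r_def)
  have "min (ereal 0) (min (ereal x) (ereal y)) = ereal l"
      "max (ereal 0) (max (ereal x) (ereal y)) = ereal r"
    using \<open>x \<le> y\<close> by (auto simp: l_def r_def min_def max_def)
  moreover have "interval_lebesgue_integrable lborel (ereal l) (ereal r) (\<lambda>s. 1 / a s)"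
    unfolding interval_lebesgue_integrable_def using lr(3)
    by (auto intro!: set_integrable_subset[OF int[OF lr(1,2)]])
  ultimately have "xi a x + interval_lebesgue_integral lborel (ereal x) (ereal y) (\<lambda>s. 1 / a s) = xi a y"
    unfolding xi_def by (intro interval_integral_sum) simp
  moreover have "interval_lebesgue_integral lborel (ereal x) (ereal y) (\<lambda>s. 1 / a s)
      = integral {x..y} (\<lambda>s. 1 / a s)"
    using assms int[of x y] by (intro interval_integral_eq_integral) auto
  ultimately have "integral {x..y} (\<lambda>s. 1 / a s) = xi a y - xi a x"
    by simp
  then show ?thesis
    using integrable_continuous_real[OF inv[of x y]] assms by (metis integrable_integral le_less_trans less_le_trans)
qed

lemma xi_mono:
  assumes "-1 < x" "x \<le> y" "y < 1"
  shows "xi a x \<le> xi a y"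
proof -
  have "0 \<le> 1 / a s" if "s \<in> {x..y}" for s
    using pos[rule_format, of s] that assms by simp
  then show ?thesis
    using has_integral_nonneg[OF has_integral_inverse_weight[OF assms]] by simp
qed

text \<open>For every c the integral of (sqrt a u_x - c / sqrt a)^2 over [x, y] is nonnegative. Its
  cross term is a multiple of u_x alone, whose integral is the increment of u, and the c^2 term
  integrates to the increment of \<open>xi a\<close>. The discriminant then gives the claim.\<close>

lemma H1a_increment:
  assumes u: "u \<in> H1a a" and xy: "-1 < x" "x \<le> y" "y < 1"
  shows "(u y - u x)\<^sup>2 \<le> (L2_norm (\<lambda>x. sqrt (a x) * deriv u x))\<^sup>2 * (xi a y - xi a x)"
proof -
  have sub: "{x..y} \<subseteq> I1"
    using xy by auto
  define h where "h s = (sqrt (a s) * deriv u s)\<^sup>2" for s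
  define N2 where "N2 = (L2_norm (\<lambda>x. sqrt (a x) * deriv u x))\<^sup>2"
  have "AE s in lebesgue_on I1. u differentiable (at s)"
    by (rule H1aD(3)[OF u])
  then have "AE s in lebesgue. s \<in> I1 \<longrightarrow> u differentiable (at s)"
    by (subst (asm) AE_restrict_space_iff) auto
  then obtain E where E: "E \<in> null_sets lebesgue" "{s. \<not> (s \<in> I1 \<longrightarrow> u differentiable (at s))} \<subseteq> E"
    by (auto simp: eventually_ae_filter)
  have der: "(deriv u has_integral u y - u x) {x..y}"
  proof (rule abs_continuous_on_has_integral)
    show "abs_continuous_on {x..y} u"
      using H1aD(2)[OF u] sub by (simp add: locally_abs_continuous_on_def)
    show "negligible E"
      using E(1) by (simp add: negligible_iff_null_sets)
    fix s
    assume "s \<in> {x..y} - E"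
    then have "s \<in> I1" "s \<notin> E"
      using sub by auto
    then have "u differentiable (at s)"
      using E(2) by blast
    then have "(u has_real_derivative deriv u s) (at s)"
      by (simp add: DERIV_deriv_iff_real_differentiable)
    then show "(u has_real_derivative deriv u s) (at s within {x..y})"
      by (rule has_field_derivative_at_within)
  qed (fact xy)
  have inth: "integrable (lebesgue_on I1) h" and N2: "N2 = (LINT s|lebesgue_on I1. h s)"
    using H1aD(4)[OF u] unfolding N2_def h_def L2_norm_sq by (simp_all add: mem_L2_iff)
  have hI: "(h has_integral N2) I1"
    unfolding N2 by (rule has_integral_integral_lebesgue_on[OF inth]) simp
  then have "h absolutely_integrable_on I1"
    by (intro nonnegative_absolutely_integrable_1) (auto simp: h_def)
  then have "h absolutely_integrable_on {x..y}"
    by (rule set_integrable_subset) (use sub in auto)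
  then have hJ: "(h has_integral integral {x..y} h) {x..y}"
    using set_lebesgue_integral_eq_integral(1) by blast
  have le: "integral {x..y} h \<le> N2"
    by (rule has_integral_subset_le[OF sub hJ hI]) (auto simp: h_def)
  have J0: "xi a y - xi a x \<ge> 0"
    using xi_mono[OF xy] by simp
  have "0 \<le> integral {x..y} h - 2 * c * (u y - u x) + c\<^sup>2 * (xi a y - xi a x)" for c
  proof (rule has_integral_nonneg)
    show "((\<lambda>s. h s - 2 * c * deriv u s + c\<^sup>2 * (1 / a s)) has_integral
        integral {x..y} h - 2 * c * (u y - u x) + c\<^sup>2 * (xi a y - xi a x)) {x..y}"
      by (intro has_integral_add has_integral_diff hJ has_integral_mult_right der
          has_integral_inverse_weight xy)
    fix s
    assume "s \<in> {x..y}"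
    then have "a s > 0"
      using sub pos by auto
    then have "h s - 2 * c * deriv u s + c\<^sup>2 * (1 / a s) = (sqrt (a s) * deriv u s - c / sqrt (a s))\<^sup>2"
      by (simp add: h_def power2_diff power_divide)
    then show "0 \<le> h s - 2 * c * deriv u s + c\<^sup>2 * (1 / a s)"
      by simp
  qed
  from quadratic_discriminant_le[OF J0 this]
  have "(u y - u x)\<^sup>2 \<le> integral {x..y} h * (xi a y - xi a x)" .
  also have "\<dots> \<le> N2 * (xi a y - xi a x)"
    using le J0 by (rule mult_right_mono)
  finally show ?thesis
    by (simp add: N2_def)
qed

lemma H1a_pointwise:
  assumes xi: "integrable (lebesgue_on I1) (xi a)" and u: "u \<in> H1a a" and x: "x \<in> I1"
  shows "(u x)\<^sup>2 \<le> sup_weight a x * (H1a_norm a u)\<^sup>2"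
proof -
  define A where "A = (L2_norm (\<lambda>x. sqrt (a x) * deriv u x))\<^sup>2"
  have "A \<ge> 0"
    by (simp add: A_def)
  \<comment> \<open>Replacing \<bar>xi a x - xi a y\<bar> by a sum separates the variables, ready
    for integration in y.\<close>
  have *: "(u x)\<^sup>2 \<le> 2 * (u y)\<^sup>2 + 2 * A * (\<bar>xi a x\<bar> + \<bar>xi a y\<bar>)" if "y \<in> I1" for y
  proof -
    have "(u x - u y)\<^sup>2 \<le> A * \<bar>xi a x - xi a y\<bar>"
      using H1a_increment[OF u, of x y] H1a_increment[OF u, of y x] x that xi_mono[of x y] xi_mono[of y x]
      by (cases "x \<le> y") (auto simp: A_def power2_commute abs_if)
    also have "\<dots> \<le> A * (\<bar>xi a x\<bar> + \<bar>xi a y\<bar>)"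
      using \<open>A \<ge> 0\<close> by (intro mult_left_mono) auto
    finally have "(u x - u y)\<^sup>2 \<le> A * (\<bar>xi a x\<bar> + \<bar>xi a y\<bar>)" .
    moreover have "(u x)\<^sup>2 \<le> 2 * (u y)\<^sup>2 + 2 * (u x - u y)\<^sup>2"
      using zero_le_power2[of "u x - 2 * u y"] by (simp add: power2_eq_square algebra_simps)
    ultimately show ?thesis
      by linarith
  qed
  have int: "integrable (lebesgue_on I1) (\<lambda>y. (u y)\<^sup>2)"
    using H1aD(1)[OF u] by (simp add: mem_L2_iff)
  have fin: "integrable (lebesgue_on I1) (\<lambda>y. c :: real)" for c
    using finite_measure.integrable_const[OF finite_measure_lebesgue_on, of I1] by simp
  \<comment> \<open>Constants in y pick up the length 2 of the interval. Dividing by it cancels the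
    factors 2 in \<open>*\<close> and leaves coefficient 2 on \<bar>xi a x\<bar> and 1 on the L^1
    norm, as in \<open>sup_weight\<close>.\<close>
  have "(LINT y|lebesgue_on I1. (u x)\<^sup>2)
      \<le> (LINT y|lebesgue_on I1. 2 * (u y)\<^sup>2 + 2 * A * (\<bar>xi a x\<bar> + \<bar>xi a y\<bar>))"
    using * int fin xi by (intro integral_mono) auto
  also have "\<dots> = 2 * (L2_norm u)\<^sup>2
      + 2 * A * (2 * \<bar>xi a x\<bar> + (LINT y|lebesgue_on I1. \<bar>xi a y\<bar>))"
    using int fin xi by (simp add: L2_norm_sq measure_restrict_space)
  finally have "(u x)\<^sup>2 \<le> (L2_norm u)\<^sup>2 + A * (2 * \<bar>xi a x\<bar> + (LINT y|lebesgue_on I1. \<bar>xi a y\<bar>))"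
    by (simp add: measure_restrict_space)
  also have "\<dots> \<le> (sup_weight a x) * (L2_norm u)\<^sup>2 + sup_weight a x * A"
    using mult_right_mono[OF sup_weight_ge_1[of a x] zero_le_power2[of "L2_norm u"]] \<open>A \<ge> 0\<close>
    by (simp add: sup_weight_def algebra_simps)
  finally show ?thesis
    by (simp add: H1a_norm_sq A_def distrib_left)
qed

section \<open>Joint continuity and the estimate on \<open>Q T\<close>\<close>

text \<open>Apply the pointwise bound to \<open>f t - f s\<close>: since the weight is bounded on
  compact parts of (-1, 1), the slices converge to \<open>f s\<close> locally uniformly in x, and
  \<open>f s\<close> is itself continuous.\<close>

lemma C_time_H1a_jointly_continuous:
  assumes xi: "integrable (lebesgue_on I1) (xi a)" and f: "f \<in> C_time T (H1a a) (H1a_norm a)"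
  shows "continuous_on ({0..T} \<times> I1) (\<lambda>z. f (fst z) (snd z))"
  unfolding continuous_on_def
proof
  fix z0 :: "real \<times> real"
  assume z0: "z0 \<in> {0..T} \<times> I1"
  obtain s y where sy: "z0 = (s, y)" "s \<in> {0..T}" "y \<in> I1"
    using z0 by auto
  have mem: "f t \<in> H1a a" if "t \<in> {0..T}" for t
    using f that by (auto simp: C_time_def)
  define g where "g t = H1a_norm a (\<lambda>x. f t x - f s x)" for t
  let ?F = "at z0 within {0..T} \<times> I1"
  have fstlim: "((\<lambda>z. fst z) \<longlongrightarrow> s) ?F" and sndlim: "((\<lambda>z. snd z) \<longlongrightarrow> y) ?F"
    using tendsto_fst[OF tendsto_ident_at, of z0] tendsto_snd[OF tendsto_ident_at, of z0] sy by auto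
  have "(g \<longlongrightarrow> 0) (at s within {0..T})"
    using f sy(2) unfolding C_time_def g_def by blast
  \<comment> \<open>A point z other than \<open>z0\<close> can still have first component s, so the
    punctured limit cannot be composed with \<open>fst\<close>. As \<open>g s\<close> is 0, the
    limit also holds along the full neighbourhood filter.\<close>
  then have "(g \<longlongrightarrow> g s) (inf (nhds s) (principal {0..T}))"
    by (simp add: tendsto_at_iff_tendsto_nhds_within g_def)
  moreover have "filterlim fst (inf (nhds s) (principal {0..T})) ?F"
    unfolding filterlim_inf filterlim_principal using fstlim
    by (auto simp: eventually_at_filter mem_Times_iff intro!: always_eventually)
  ultimately have "((\<lambda>z. g (fst z)) \<longlongrightarrow> g s) ?F"
    by (rule filterlim_compose)
  then have g0: "((\<lambda>z. g (fst z)) \<longlongrightarrow> 0) ?F"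
    by (simp add: g_def)
  define r where "r = (1 + \<bar>y\<bar>) / 2"
  have r: "-r < y" "y < r" "r < 1" "-1 < -r"
    using sy by (auto simp: r_def abs_if field_simps)
  \<comment> \<open>By monotonicity, \<open>xi a\<close> on (-r, r) lies between its values at the
    endpoints.\<close>
  define B where "B = 1 + 2 * (\<bar>xi a r\<bar> + \<bar>xi a (-r)\<bar>) + (LINT y|lebesgue_on I1. \<bar>xi a y\<bar>)"
  have B: "sup_weight a x \<le> B" if "x \<in> {-r<..<r}" for x
    using xi_mono[of x r] xi_mono[of "-r" x] that r
    by (auto simp: sup_weight_def B_def)
  have bound: "\<bar>f t x - f s x\<bar> \<le> sqrt B * g t" if "t \<in> {0..T}" "x \<in> {-r<..<r}" for t x
  proof -
    have "(f t x - f s x)\<^sup>2 \<le> sup_weight a x * (g t)\<^sup>2"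
      using H1a_pointwise[OF xi H1a_diff(1)[OF mem[OF that(1)] mem[OF sy(2)]], of x] that r
      by (auto simp: g_def)
    also have "\<dots> \<le> B * (g t)\<^sup>2"
      using B[OF that(2)] by (rule mult_right_mono) simp
    finally have "sqrt ((f t x - f s x)\<^sup>2) \<le> sqrt (B * (g t)\<^sup>2)"
      by (rule real_sqrt_le_mono)
    then show ?thesis
      by (simp add: real_sqrt_mult g_def)
  qed
  have "\<forall>\<^sub>F z in ?F. snd z \<in> {-r<..<r}"
    using topological_tendstoD[OF sndlim, of "{-r<..<r}"] r by auto
  moreover have "\<forall>\<^sub>F z in ?F. fst z \<in> {0..T}"
    by (auto simp: eventually_at_filter intro!: always_eventually)
  ultimately have "\<forall>\<^sub>F z in ?F. norm (f (fst z) (snd z) - f s (snd z)) \<le> sqrt B * g (fst z)"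
    by eventually_elim (use bound in auto)
  moreover have "((\<lambda>z. sqrt B * g (fst z)) \<longlongrightarrow> 0) ?F"
    using tendsto_mult_right_zero[OF g0] by simp
  ultimately have "((\<lambda>z. f (fst z) (snd z) - f s (snd z)) \<longlongrightarrow> 0) ?F"
    by (rule Lim_null_comparison)
  moreover have "isCont (f s) y"
    using H1a_imp_continuous_on[OF mem[OF sy(2)]] sy(3)
    by (simp add: continuous_on_eq_continuous_at)
  then have "((\<lambda>z. f s (snd z)) \<longlongrightarrow> f s y) ?F"
    using sndlim by (rule isCont_tendsto_compose)
  ultimately have "((\<lambda>z. (f (fst z) (snd z) - f s (snd z)) + f s (snd z)) \<longlongrightarrow> 0 + f s y) ?F"
    by (rule tendsto_add)
  then show "((\<lambda>z. f (fst z) (snd z)) \<longlongrightarrow> f (fst z0) (snd z0)) ?F"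
    by (simp add: sy)
qed

lemma HQ_Lp_estimate:
  assumes \<theta>: "\<theta> \<ge> 1" and xi: "xi a \<in> Lp (2 * \<theta> - 1) (lebesgue_on I1)"
    and T: "T > 0" and u: "u \<in> HQ a T"
  shows "u \<in> Lp (2 * \<theta>) (lebesgue_on (Q T))"
    and "Lp_norm (2 * \<theta>) (lebesgue_on (Q T)) u
      \<le> (LINT x|lebesgue_on I1. sup_weight a x powr \<theta>) powr (1 / (2 * \<theta>))
        * T powr (1 / (2 * \<theta>)) * HQ_norm a T u"
proof -
  define M where "M = HQ_norm a T u"
  define C where "C = (LINT x|lebesgue_on I1. sup_weight a x powr \<theta>)"
  note xi_int = integrable_sup_weight_powr[OF \<theta> xi]
  have C0: "C \<ge> 0"
    unfolding C_def by (rule Bochner_Integration.integral_nonneg) simp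
  have uC: "curry u \<in> C_time T (H1a a) (H1a_norm a)"
    using u by (simp add: HQ_def)
  have M: "H1a_norm a (curry u t) \<le> M" if "t \<in> {0..T}" for t
    unfolding M_def by (rule H1a_norm_le_HQ_norm[OF u that])
  \<comment> \<open>\<open>M\<close> dominates the norm of the slice at time 0.\<close>
  have M0: "M \<ge> 0"
    using order_trans[OF H1a_norm_nonneg M[of 0]] T by simp
  have Qo: "open (Q T)"
    by (simp add: Q_def open_Times)
  have "continuous_on ({0..T} \<times> I1) u"
    using C_time_H1a_jointly_continuous[OF xi_int(1) uC] by (simp add: curry_def)
  then have uc: "continuous_on (Q T) u"
    by (rule continuous_on_subset) (auto simp: Q_def)
  then have um: "u \<in> borel_measurable (lebesgue_on (Q T))"
    using Qo by (intro continuous_imp_measurable_on_sets_lebesgue) auto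
  \<comment> \<open>The cutoff makes a Borel function on the plane from \<open>u\<close>, which is
    known to be continuous only on the open set \<open>Q T\<close>.\<close>
  define g where "g z = indicator (Q T) z * \<bar>u z\<bar> powr (2 * \<theta>)" for z
  have gm: "g \<in> borel_measurable borel"
    unfolding g_def real_scaleR_def[symmetric]
    using Qo uc \<theta> by (intro borel_measurable_continuous_on_indicator continuous_on_powr' continuous_intros) auto
  have bound: "g (t, x) \<le> sup_weight a x powr \<theta> * M powr (2 * \<theta>)" if "t \<in> {0<..<T}" "x \<in> I1" for t x
  proof -
    have tT: "t \<in> {0..T}"
      using that by auto
    then have mem: "curry u t \<in> H1a a"
      using uC by (auto simp: C_time_def)
    have "(u (t, x))\<^sup>2 \<le> sup_weight a x * (H1a_norm a (curry u t))\<^sup>2"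
      using H1a_pointwise[OF xi_int(1) mem that(2)] by simp
    also have "\<dots> \<le> sup_weight a x * M\<^sup>2"
      using sup_weight_ge_1[of a x] M[OF tT] by (intro mult_left_mono power_mono) auto
    \<comment> \<open>Squares are rewritten with \<open>powr\<close> so that raising to the real
      exponent \<theta> combines with them.\<close>
    finally have "(\<bar>u (t, x)\<bar> powr 2) powr \<theta> \<le> (sup_weight a x * M powr 2) powr \<theta>"
      using \<theta> M0 by (intro powr_mono2) auto
    also have "\<dots> = sup_weight a x powr \<theta> * M powr (2 * \<theta>)"
      using sup_weight_ge_1[of a x] M0 by (simp add: powr_mult powr_powr del: powr_numeral)
    finally show ?thesis
      using that by (simp add: g_def Q_def powr_powr del: powr_numeral)
  qed
  have g0: "g z \<ge> 0" and supp: "z \<notin> Q T \<Longrightarrow> g z = 0" for z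
    by (simp_all add: g_def)
  have w: "integrable (lebesgue_on I1) (\<lambda>x. sup_weight a x powr \<theta> * M powr (2 * \<theta>))"
    using xi_int(2) by simp
  have int: "integrable lborel g" and le: "integral\<^sup>L lborel g \<le> T * (C * M powr (2 * \<theta>))"
    using integral_Q_le[OF gm g0 T supp bound w] by (simp_all add: C_def)
  have "integrable lebesgue g"
    using int gm by (simp add: integrable_completion)
  then have int': "integrable (lebesgue_on (Q T)) (\<lambda>z. \<bar>u z\<bar> powr (2 * \<theta>))"
    using Qo by (subst integrable_restrict_space) (auto simp: g_def[abs_def])
  with um show "u \<in> Lp (2 * \<theta>) (lebesgue_on (Q T))"
    by (simp add: Lp_def)
  have "(LINT z|lebesgue_on (Q T). \<bar>u z\<bar> powr (2 * \<theta>)) = integral\<^sup>L lebesgue g"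
    using Qo by (subst integral_restrict_space) (auto simp: g_def[abs_def])
  also have "\<dots> = integral\<^sup>L lborel g"
    using gm by (simp add: integral_completion)
  finally have "(LINT z|lebesgue_on (Q T). \<bar>u z\<bar> powr (2 * \<theta>)) \<le> T * (C * M powr (2 * \<theta>))"
    using le by simp
  moreover have "(LINT z|lebesgue_on (Q T). \<bar>u z\<bar> powr (2 * \<theta>)) \<ge> 0"
    by (rule Bochner_Integration.integral_nonneg) simp
  ultimately have "Lp_norm (2 * \<theta>) (lebesgue_on (Q T)) u
      \<le> (T * (C * M powr (2 * \<theta>))) powr (1 / (2 * \<theta>))"
    unfolding Lp_norm_def using \<theta> by (intro powr_mono2) auto
  also have "\<dots> = C powr (1 / (2 * \<theta>)) * T powr (1 / (2 * \<theta>)) * M"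
    using T C0 M0 \<theta> by (simp add: powr_mult powr_powr)
  finally show "Lp_norm (2 * \<theta>) (lebesgue_on (Q T)) u
      \<le> (LINT x|lebesgue_on I1. sup_weight a x powr \<theta>) powr (1 / (2 * \<theta>))
        * T powr (1 / (2 * \<theta>)) * HQ_norm a T u"
    by (simp add: C_def M_def)
qed

end

theorem corollary3p6:
  fixes a :: "real \<Rightarrow> real" and \<theta> :: real
  assumes "C1_on {-1..1} a"
    and "\<forall>x\<in>{-1<..<1}. a x > 0"
    and "a (-1) = 0" and "a 1 = 0"
    and "\<theta> \<ge> 1"
    and "xi a \<in> Lp (2 * \<theta> - 1) (lebesgue_on {-1<..<1})"
  shows "(\<forall>T>0. HQ a T \<subseteq> Lp (2 * \<theta>) (lebesgue_on (Q T))) \<and>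
         (\<exists>c>0. \<forall>T>0. \<forall>u\<in>HQ a T.
            Lp_norm (2 * \<theta>) (lebesgue_on (Q T)) u \<le> c * T powr (1 / (2 * \<theta>)) * HQ_norm a T u)"
proof -
  have "continuous_on {-1..1} a"
    using assms(1) by (auto simp: C1_on_def intro: DERIV_continuous_on)
  then have cont: "continuous_on I1 a"
    by (rule continuous_on_subset) auto
  define c where "c = (LINT x|lebesgue_on I1. sup_weight a x powr \<theta>) powr (1 / (2 * \<theta>))"
  \<comment> \<open>Adding 1 makes the constant visibly positive; since \<open>HQ_norm\<close> is
    nonnegative, this only enlarges the right side. \<open>c\<close> is fixed before T, so the
    constant is uniform in T.\<close>
  have est: "Lp_norm (2 * \<theta>) (lebesgue_on (Q T)) u \<le> (c + 1) * T powr (1 / (2 * \<theta>)) * HQ_norm a T u"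
    if T: "T > 0" and u: "u \<in> HQ a T" for T u
  proof -
    have "0 \<le> HQ_norm a T u"
      using order_trans[OF H1a_norm_nonneg H1a_norm_le_HQ_norm[OF u, of 0]] T by simp
    then have "c * T powr (1 / (2 * \<theta>)) * HQ_norm a T u
        \<le> (c + 1) * T powr (1 / (2 * \<theta>)) * HQ_norm a T u"
      by (intro mult_right_mono) auto
    then show ?thesis
      using HQ_Lp_estimate(2)[OF cont assms(2,5,6) T u] unfolding c_def by linarith
  qed
  have "c + 1 > 0"
    unfolding c_def by (rule add_nonneg_pos) auto
  with est have "\<exists>c>0. \<forall>T>0. \<forall>u\<in>HQ a T.
      Lp_norm (2 * \<theta>) (lebesgue_on (Q T)) u \<le> c * T powr (1 / (2 * \<theta>)) * HQ_norm a T u"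
    by blast
  then show ?thesis
    using HQ_Lp_estimate(1)[OF cont assms(2,5,6)] by blast
qed

end
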